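(* Let $a,b$ be positive integers with $a\neq b$. Then $t(a,b)=a+b$.
   Context: An $r$-graph is a hypergraph all of whose edges have exactly $r$ vertices. A hypergraph is intersecting if every two of its edges have nonempty intersection. For a hypergraph $H$, $\tau(H)$ is the minimum size of a cover, i.e. of a vertex set meeting every edge. Given a vector $\vec{a}=(a_1,\ldots,a_p)$ of positive integers with $\sum_{i\le p}a_i=r$, an $r$-graph $H$ is $\vec{a}$-partitioned if $V(H)=\bigcup_{i\le p}V_i$ with the $V_i$ pairwise disjoint and $|e\cap V_i|=a_i$ for every edge $e\in H$ and every $i\le p$. $t(\vec{a})$ (written $t(a_1,\ldots,a_p)$) denotes the maximum of $\tau(H)$ over all (finite) intersecting $\vec{a}$-partitioned $r$-graphs $H$. *)

theory Defs
  imports Main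
begin

definition hypergraph :: "'a set \<Rightarrow> 'a set set \<Rightarrow> bool" where
  "hypergraph V E \<longleftrightarrow> finite V \<and> E \<subseteq> Pow V"

definition r_graph :: "nat \<Rightarrow> 'a set \<Rightarrow> 'a set set \<Rightarrow> bool" where
  "r_graph r V E \<longleftrightarrow> hypergraph V E \<and> (\<forall>e\<in>E. card e = r)"

definition intersecting :: "'a set set \<Rightarrow> bool" where
  "intersecting E \<longleftrightarrow> (\<forall>e\<in>E. \<forall>f\<in>E. e \<inter> f \<noteq> {})"

definition is_cover :: "'a set \<Rightarrow> 'a set set \<Rightarrow> 'a set \<Rightarrow> bool" where
  "is_cover V E C \<longleftrightarrow> C \<subseteq> V \<and> (\<forall>e\<in>E. C \<inter> e \<noteq> {})"

definition tau :: "'a set \<Rightarrow> 'a set set \<Rightarrow> nat" where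
  "tau V E = Min {card C |C. is_cover V E C}"

definition partitioned :: "nat list \<Rightarrow> 'a set \<Rightarrow> 'a set set \<Rightarrow> bool" where
  "partitioned as V E \<longleftrightarrow>
     (\<exists>P :: nat \<Rightarrow> 'a set.
        V = (\<Union>i<length as. P i) \<and>
        (\<forall>i<length as. \<forall>j<length as. i \<noteq> j \<longrightarrow> P i \<inter> P j = {}) \<and>
        (\<forall>e\<in>E. \<forall>i<length as. card (e \<inter> P i) = as ! i))"

definition admissible :: "nat list \<Rightarrow> 'a set \<Rightarrow> 'a set set \<Rightarrow> bool" where
  "admissible as V E \<longleftrightarrow>
     r_graph (sum_list as) V E \<and> intersecting E \<and> partitioned as V E"

text \<open>
  Up to isomorphism every finite hypergraph has its vertices in the natural numbers, so the
  maximum may be taken over vertex type \<^typ>\<open>nat\<close>; the lemmas below show that it exists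
  and that it bounds the cover number of admissible hypergraphs over any vertex type.
\<close>

definition t :: "nat list \<Rightarrow> nat" where
  "t as = Max {tau V E |(V :: nat set) E. admissible as V E}"

lemma finite_cover_sizes:
  assumes "finite V"
  shows "finite {card C |C. is_cover V E C}"
proof -
  have "{card C |C. is_cover V E C} \<subseteq> card ` Pow V"
    by (auto simp: is_cover_def)
  then show ?thesis
    using assms by (meson finite_Pow_iff finite_imageI finite_subset)
qed

lemma tau_le:
  assumes "finite V" "is_cover V E C"
  shows "tau V E \<le> card C"
  unfolding tau_def by (rule Min_le[OF finite_cover_sizes[OF assms(1)]]) (use assms in auto)

lemma tau_le_sum_list:
  assumes "admissible as V E"
  shows "tau V E \<le> sum_list as"
proof (cases "E = {}")
  case True
  have "is_cover V E {}" by (simp add: True is_cover_def)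
  with assms have "tau V E \<le> card ({} :: 'a set)"
    by (intro tau_le) (auto simp: admissible_def r_graph_def hypergraph_def)
  then show ?thesis by simp
next
  case False
  then obtain e where e: "e \<in> E" by blast
  have "is_cover V E e"
    using assms e by (auto simp: is_cover_def admissible_def r_graph_def hypergraph_def intersecting_def)
  with assms have "tau V E \<le> card e"
    by (intro tau_le) (auto simp: admissible_def r_graph_def hypergraph_def)
  also have "card e = sum_list as"
    using assms e by (auto simp: admissible_def r_graph_def)
  finally show ?thesis .
qed

lemma finite_tau_values: "finite {tau V E |(V :: nat set) E. admissible as V E}"
  by (rule finite_subset[of _ "{..sum_list as}"]) (auto intro: tau_le_sum_list)

lemma tau_values_nonempty: "{tau V E |(V :: nat set) E. admissible as V E} \<noteq> {}"
proof -
  have "admissible as ({} :: nat set) {}"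
    by (auto simp: admissible_def r_graph_def hypergraph_def intersecting_def partitioned_def
        intro!: exI[of _ "\<lambda>_. {}"])
  then show ?thesis by blast
qed

lemma is_cover_image:
  assumes "inj_on g V" "E \<subseteq> Pow V" "C \<subseteq> V"
  shows "is_cover (g ` V) ((`) g ` E) (g ` C) \<longleftrightarrow> is_cover V E C"
proof -
  have "g ` C \<inter> g ` e = g ` (C \<inter> e)" if "e \<in> E" for e
    using inj_on_image_Int[OF assms(1,3), of e] assms(2) that by auto
  then show ?thesis using assms(3) by (auto simp: is_cover_def)
qed

lemma tau_image:
  assumes "inj_on g V" "E \<subseteq> Pow V"
  shows "tau (g ` V) ((`) g ` E) = tau V E"
proof -
  have card: "card (g ` C) = card C" if "C \<subseteq> V" for C
    using assms(1) that by (meson card_image inj_on_subset)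
  have "{card C |C. is_cover (g ` V) ((`) g ` E) C} = {card C |C. is_cover V E C}"
  proof (intro equalityI subsetI)
    fix n assume "n \<in> {card C |C. is_cover (g ` V) ((`) g ` E) C}"
    then obtain D where D: "n = card D" "is_cover (g ` V) ((`) g ` E) D" by blast
    then obtain C where C: "C \<subseteq> V" "D = g ` C"
      unfolding is_cover_def by (meson subset_imageE)
    then show "n \<in> {card C |C. is_cover V E C}"
      using D is_cover_image[OF assms C(1)] card[OF C(1)] by auto
  next
    fix n assume "n \<in> {card C |C. is_cover V E C}"
    then obtain C where C: "n = card C" "is_cover V E C" by blast
    then have "C \<subseteq> V" by (simp add: is_cover_def)
    then have "n = card (g ` C) \<and> is_cover (g ` V) ((`) g ` E) (g ` C)"
      using C is_cover_image[OF assms] card by simp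
    then show "n \<in> {card C |C. is_cover (g ` V) ((`) g ` E) C}" by blast
  qed
  then show ?thesis by (simp add: tau_def)
qed

lemma admissible_image:
  assumes "inj_on g V" "admissible as V E"
  shows "admissible as (g ` V) ((`) g ` E)"
proof -
  have V: "finite V" "E \<subseteq> Pow V" "\<forall>e\<in>E. card e = sum_list as" "intersecting E"
    using assms(2) by (auto simp: admissible_def r_graph_def hypergraph_def)
  obtain P where P: "V = (\<Union>i<length as. P i)"
      "\<forall>i<length as. \<forall>j<length as. i \<noteq> j \<longrightarrow> P i \<inter> P j = {}"
      "\<forall>e\<in>E. \<forall>i<length as. card (e \<inter> P i) = as ! i"
    using assms(2) unfolding admissible_def partitioned_def by blast
  have PV: "P i \<subseteq> V" if "i < length as" for i using P(1) that by blast
  have Int: "g ` A \<inter> g ` B = g ` (A \<inter> B)" if "A \<subseteq> V" "B \<subseteq> V" for A B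
    using inj_on_image_Int[OF assms(1) that] by simp
  have card: "card (g ` C) = card C" if "C \<subseteq> V" for C
    using assms(1) that by (meson card_image inj_on_subset)
  have 1: "r_graph (sum_list as) (g ` V) ((`) g ` E)"
    using V card by (auto simp: r_graph_def hypergraph_def)
  have 2: "intersecting ((`) g ` E)"
    unfolding intersecting_def
  proof (intro ballI)
    fix e' f' assume "e' \<in> (`) g ` E" "f' \<in> (`) g ` E"
    then obtain e f where ef: "e \<in> E" "f \<in> E" "e' = g ` e" "f' = g ` f" by blast
    then have "e' \<inter> f' = g ` (e \<inter> f)" using Int[of e f] V(2) by auto
    moreover have "e \<inter> f \<noteq> {}" using V(4) ef by (simp add: intersecting_def)
    ultimately show "e' \<inter> f' \<noteq> {}" by simp
  qed
  have 3: "card (g ` e \<inter> g ` P i) = as ! i" if "e \<in> E" "i < length as" for e i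
  proof -
    have "e \<subseteq> V" using V(2) that by blast
    then have "g ` e \<inter> g ` P i = g ` (e \<inter> P i)" "e \<inter> P i \<subseteq> V"
      using Int[OF _ PV[OF that(2)]] by blast+
    then have "card (g ` e \<inter> g ` P i) = card (e \<inter> P i)" using card by simp
    then show ?thesis using P(3) that by simp
  qed
  have 4: "g ` P i \<inter> g ` P j = {}" if "i < length as" "j < length as" "i \<noteq> j" for i j
    using Int[OF PV PV] P(2) that by simp
  have "partitioned as (g ` V) ((`) g ` E)"
    unfolding partitioned_def
  proof (intro exI[of _ "\<lambda>i. g ` P i"] conjI)
    show "g ` V = (\<Union>i<length as. g ` P i)" unfolding P(1) by (rule image_UN)
  qed (use 3 4 in blast)+
  with 1 2 show ?thesis by (simp add: admissible_def)
qed

lemma tau_le_t: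
  fixes V :: "'a set"
  assumes "admissible as V E"
  shows "tau V E \<le> t as"
proof -
  have V: "finite V" "E \<subseteq> Pow V"
    using assms by (auto simp: admissible_def r_graph_def hypergraph_def)
  obtain g :: "'a \<Rightarrow> nat" where g: "inj_on g V"
    using V(1) finite_imp_inj_to_nat_seg by blast
  have "tau (g ` V) ((`) g ` E) \<le> t as"
    unfolding t_def using admissible_image[OF g assms] finite_tau_values
    by (intro Max_ge) blast+
  then show ?thesis by (simp add: tau_image[OF g V(2)])
qed

end

theory Submission
  imports Defs
begin

text \<open>
  The lower bound goes by induction along \<open>(a, b) \<mapsto> (a + 1, b + 1)\<close>, starting from \<open>(k, 0)\<close> with
  \<open>k > 0\<close>, where all \<open>k\<close>-subsets of \<open>2k - 1\<close> points will do, and from \<open>(0, k)\<close> by symmetry.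
  Let \<open>H\<close> be extremal for \<open>(a, b)\<close> and add \<open>n = a + b + 2\<close> disjoint pairs \<open>{u\<^sub>i, z\<^sub>i}\<close> with
  \<open>u\<^sub>i\<close> on the first side and \<open>z\<^sub>i\<close> on the second. The new edges are all
  \<open>e \<union> {u\<^sub>i, z\<^sub>i}\<close> with \<open>e \<in> H\<close>, and all transversals of the pairs that choose \<open>a + 1\<close> of the
  \<open>u\<^sub>i\<close> and \<open>b + 1\<close> of the \<open>z\<^sub>i\<close>. Two disjoint transversals would be complementary, which is
  impossible since \<open>a \<noteq> b\<close>; so the new hypergraph is intersecting. A cover either meets all \<open>n\<close>
  pairs, or it covers \<open>H\<close>, using \<open>a + b\<close> old vertices, and needs at least two new vertices to
  meet all transversals.
\<close>

text \<open>Only the lower bound on covers is recorded, since any edge of an intersecting family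
  gives the upper one. \<open>C\<close> may leave \<open>V \<union> W\<close>, so no containment has
  to be carried through the induction; \<open>a\<close> or \<open>b\<close> may be 0, which is where
  the induction starts.\<close>

definition extremal :: "nat \<Rightarrow> nat \<Rightarrow> 'a set \<Rightarrow> 'a set \<Rightarrow> 'a set set \<Rightarrow> bool" where
  "extremal a b V W E \<longleftrightarrow> finite V \<and> finite W \<and> V \<inter> W = {} \<and>
     (\<forall>e\<in>E. e \<subseteq> V \<union> W \<and> card (e \<inter> V) = a \<and> card (e \<inter> W) = b) \<and> intersecting E \<and>
     (\<forall>C. finite C \<longrightarrow> (\<forall>e\<in>E. C \<inter> e \<noteq> {}) \<longrightarrow> a + b \<le> card C)"

lemma extremal_swap: "extremal a b V W E \<Longrightarrow> extremal b a W V E"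
  by (auto simp: extremal_def Un_commute Int_commute add.commute)

text \<open>Two disjoint \<open>k\<close>-sets need \<open>2 * k\<close> points, and fewer than
  \<open>k\<close> points leave at least \<open>k\<close> uncovered, enough to contain an
  edge.\<close>

lemma extremal_majority:
  assumes "k > 0"
  shows "extremal k 0 {..<2 * k - 1} {} {e. e \<subseteq> {..<2 * k - 1 :: nat} \<and> card e = k}"
    (is "extremal k 0 ?V {} ?E")
proof -
  have "e \<inter> f \<noteq> {}" if "e \<in> ?E" "f \<in> ?E" for e f
  proof
    assume "e \<inter> f = {}"
    then have "card (e \<union> f) = 2 * k"
      using that by (subst card_Un_disjoint) (auto intro: finite_subset)
    moreover have "card (e \<union> f) \<le> card ?V"
      using that by (intro card_mono) auto
    ultimately show False using assms by simp
  qed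
  moreover have "k \<le> card C" if "finite C" and C: "\<forall>e\<in>?E. C \<inter> e \<noteq> {}" for C
  proof (rule ccontr)
    assume "\<not> k \<le> card C"
    then have "k \<le> card (?V - C)"
      using diff_card_le_card_Diff[OF \<open>finite C\<close>, of ?V] by simp
    then obtain e where "e \<subseteq> ?V - C" "card e = k"
      by (meson obtain_subset_with_card_n)
    then show False using C by blast
  qed
  ultimately show ?thesis
    by (auto simp: extremal_def intersecting_def Int_absorb2)
qed

lemma extremal_Suc_Suc:
  fixes V W :: "nat set"
  assumes ext: "extremal a b V W E" and "a \<noteq> b"
  shows "\<exists>(V' :: nat set) W' E'. extremal (Suc a) (Suc b) V' W' E'"
proof -
  have fin: "finite V" "finite W" and disj: "V \<inter> W = {}"
    and E: "\<And>e. e \<in> E \<Longrightarrow> e \<subseteq> V \<union> W \<and> card (e \<inter> V) = a \<and> card (e \<inter> W) = b"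
    and inter: "\<And>e f. e \<in> E \<Longrightarrow> f \<in> E \<Longrightarrow> e \<inter> f \<noteq> {}"
    and cover: "\<And>C. finite C \<Longrightarrow> \<forall>e\<in>E. C \<inter> e \<noteq> {} \<Longrightarrow> a + b \<le> card C"
    using ext unfolding extremal_def intersecting_def by simp_all
  obtain N where N: "V \<union> W \<subseteq> {..<N}"
    using fin finite_nat_set_iff_bounded[of "V \<union> W"] by auto
  \<comment> \<open>This is the new edge size: a transversal has one vertex per pair, and a cover
    meeting every pair is already large enough.\<close>
  define n where "n = a + b + 2"
  \<comment> \<open>Even and odd offsets from \<open>N\<close> keep all new vertices distinct and
    outside \<open>V \<union> W\<close>.\<close>
  define u where "u i = N + 2 * i" for i
  define z where "z i = N + 2 * i + 1" for i
  have inj: "inj_on u I" "inj_on z I" for I by (auto simp: u_def z_def inj_on_def)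
  have uz [simp]: "u i \<noteq> z j" "z j \<noteq> u i" for i j unfolding u_def z_def by presburger+
  have uu [simp]: "u i = u j \<longleftrightarrow> i = j" "z i = z j \<longleftrightarrow> i = j" for i j by (auto simp: u_def z_def)
  have new [simp]: "u i \<notin> V" "u i \<notin> W" "z i \<notin> V" "z i \<notin> W" for i
    using N by (auto simp: u_def z_def)
  define T where "T I = u ` I \<union> z ` ({..<n} - I)" for I
  define \<I> where "\<I> = {I. I \<subseteq> {..<n} \<and> card I = Suc a}"
  define V' where "V' = V \<union> u ` {..<n}"
  define W' where "W' = W \<union> z ` {..<n}"
  define E' where "E' = {e \<union> {u i, z i} |e i. e \<in> E \<and> i < n} \<union> T ` \<I>"
  have "finite V'" "finite W'" "V' \<inter> W' = {}"
    using fin disj by (auto simp: V'_def W'_def)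
  moreover have "f \<subseteq> V' \<union> W' \<and> card (f \<inter> V') = Suc a \<and> card (f \<inter> W') = Suc b"
    if "f \<in> E'" for f
  proof -
    from that consider e i where "e \<in> E" "i < n" "f = e \<union> {u i, z i}"
      | I where "I \<in> \<I>" "f = T I"
      unfolding E'_def by blast
    then show ?thesis
    proof cases
      case 1
      then have "e \<subseteq> V \<union> W" using E by blast
      then have nin: "u i \<notin> e" "z i \<notin> e" "\<And>j. u j \<notin> e" "\<And>j. z j \<notin> e"
        using new by blast+
      have "f \<inter> V' = insert (u i) (e \<inter> V)" "f \<inter> W' = insert (z i) (e \<inter> W)"
        using 1 nin by (auto simp: V'_def W'_def)
      moreover have "f \<subseteq> V' \<union> W'"
        using 1 \<open>e \<subseteq> V \<union> W\<close> by (auto simp: V'_def W'_def)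
      ultimately show ?thesis using E[OF 1(1)] fin nin by simp
    next
      case 2
      then have I: "I \<subseteq> {..<n}" "card I = Suc a" by (auto simp: \<I>_def)
      have eq: "f \<inter> V' = u ` I" "f \<inter> W' = z ` ({..<n} - I)"
        using 2 I by (auto simp: V'_def W'_def T_def)
      have "card ({..<n} - I) = Suc b"
        using I by (subst card_Diff_subset) (auto simp: n_def intro: finite_subset)
      moreover have "f \<subseteq> V' \<union> W'"
        using I 2 by (auto simp: V'_def W'_def T_def)
      ultimately show ?thesis using I by (simp add: eq card_image inj)
    qed
  qed
  moreover have "intersecting E'"
  proof -
    have pair: "(e \<union> {u i, z i}) \<inter> T I \<noteq> {}" "T I \<inter> (e \<union> {u i, z i}) \<noteq> {}"
      if "i < n" for e i I
      using that by (cases "i \<in> I"; auto simp: T_def)+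
    have transversals: "T I \<inter> T J \<noteq> {}" if "I \<in> \<I>" "J \<in> \<I>" for I J
    proof
      assume dis: "T I \<inter> T J = {}"
      have sub: "I \<subseteq> {..<n}" "J \<subseteq> {..<n}" "card I = Suc a" "card J = Suc a"
        using that by (auto simp: \<I>_def)
      have "I \<inter> J = {}" using dis by (auto simp: T_def)
      \<comment> \<open>An index outside both \<open>I\<close> and \<open>J\<close> would put its
        \<open>z\<close> into both transversals. So \<open>n = 2 * (a + 1)\<close>, which forces
        \<open>a = b\<close>.\<close>
      moreover have "{..<n} = I \<union> J" using dis sub by (auto simp: T_def)
      ultimately have "card {..<n} = card I + card J"
        by (metis card_Un_disjoint finite_Un finite_lessThan)
      then show False using sub \<open>a \<noteq> b\<close> by (simp add: n_def)
    qed
    have old: "(e \<union> {u i, z i}) \<inter> (f \<union> {u j, z j}) \<noteq> {}"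
      if "e \<in> E" "f \<in> E" for e f i j using inter[OF that] by blast
    show ?thesis
      unfolding intersecting_def E'_def
      by (intro ballI, elim UnE CollectE exE conjE imageE)
        (simp_all only: pair transversals old not_False_eq_True)
  qed
  moreover have "Suc a + Suc b \<le> card C" if "finite C" and C: "\<forall>e\<in>E'. C \<inter> e \<noteq> {}" for C
  proof (cases "\<forall>i<n. u i \<in> C \<or> z i \<in> C")
    case True
    \<comment> \<open>One vertex of \<open>C\<close> from each pair; the pairs are disjoint, so
      \<open>g\<close> is injective.\<close>
    define g where "g i = (if u i \<in> C then u i else z i)" for i
    have "inj_on g {..<n}" by (auto simp: g_def inj_on_def split: if_splits)
    moreover have "g ` {..<n} \<subseteq> C" using True by (auto simp: g_def)
    ultimately have "n \<le> card C"
      using \<open>finite C\<close> by (metis card_image card_lessThan card_mono)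
    then show ?thesis by (simp add: n_def)
  next
    case False
    then obtain i where i: "i < n" "u i \<notin> C" "z i \<notin> C" by blast
    define O' where "O' = C \<inter> (V \<union> W)"
    define D where "D = C - (V \<union> W)"
    have "O' \<inter> e \<noteq> {}" if "e \<in> E" for e
    proof -
      have "e \<union> {u i, z i} \<in> E'" using that i by (auto simp: E'_def)
      from bspec[OF C this] have "C \<inter> e \<noteq> {}" using i by simp
      moreover have "e \<subseteq> V \<union> W" using E[OF that] by simp
      ultimately show ?thesis by (auto simp: O'_def)
    qed
    then have "a + b \<le> card O'" using \<open>finite C\<close> by (intro cover) (auto simp: O'_def)
    moreover have "2 \<le> card D"
    proof (rule ccontr)
      assume "\<not> 2 \<le> card D"
      moreover have "finite D" using \<open>finite C\<close> by (simp add: D_def)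
      \<comment> \<open>If \<open>D\<close> is empty, \<open>x\<close> is arbitrary, so it need not
        be a new vertex.\<close>
      ultimately obtain x where x: "D \<subseteq> {x}"
        by (metis One_nat_def card_0_eq card_1_singletonE empty_subsetI less_2_cases not_le order_refl)
      have "\<exists>I\<in>\<I>. x \<notin> T I"
      proof (cases "\<exists>j<n. x = z j")
        case True
        then obtain j where j: "j < n" "x = z j" by blast
        \<comment> \<open>With \<open>j\<close> in the index set, the transversal takes
          \<open>u j\<close> and so avoids \<open>x = z j\<close>.\<close>
        have "a \<le> card ({..<n} - {j})" using j by (simp add: n_def)
        then obtain J where J: "J \<subseteq> {..<n} - {j}" "card J = a" "finite J"
          by (meson obtain_subset_with_card_n)
        then have "insert j J \<in> \<I>" using j by (auto simp: \<I>_def card_insert_if)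
        then show ?thesis using j by (auto simp: T_def intro!: bexI[of _ "insert j J"])
      next
        case no_z: False
        \<comment> \<open>As \<open>u\<close> is injective, at most one index gives
          \<open>x\<close>; \<open>j\<close> is that index if it exists and arbitrary otherwise. An
          \<open>I\<close> without \<open>j\<close> then avoids \<open>x\<close>.\<close>
        obtain j where j: "x \<noteq> u i" if "i \<noteq> j" for i by (metis uu(1))
        have "Suc a \<le> card ({..<n} - {j})"
          by (cases "j < n") (auto simp: n_def)
        then obtain I where I: "I \<subseteq> {..<n} - {j}" "card I = Suc a"
          by (meson obtain_subset_with_card_n)
        then have "x \<notin> T I" using no_z j by (auto simp: T_def)
        then show ?thesis using I by (auto simp: \<I>_def)
      qed
      then obtain I where I: "I \<in> \<I>" "x \<notin> T I" by blast
      then have "T I \<in> E'" by (simp add: E'_def)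
      with C have "C \<inter> T I \<noteq> {}" by (rule bspec)
      moreover have "T I \<inter> (V \<union> W) = {}" by (auto simp: T_def)
      ultimately show False using I x by (auto simp: D_def)
    qed
    moreover have "card C = card O' + card D"
      unfolding O'_def D_def using \<open>finite C\<close>
      by (subst card_Un_disjoint[symmetric]) (auto intro!: arg_cong[where f = card])
    ultimately show ?thesis by simp
  qed
  ultimately have "extremal (Suc a) (Suc b) V' W' E'" by (simp add: extremal_def)
  then show ?thesis by blast
qed

lemma ex_extremal:
  assumes "a \<noteq> b"
  shows "\<exists>(V :: nat set) W E. extremal a b V W E"
  using assms
proof (induction a arbitrary: b)
  case 0
  then have "extremal 0 b {} {..<2 * b - 1} {e. e \<subseteq> {..<2 * b - 1} \<and> card e = b}"
    using extremal_swap[OF extremal_majority[of b]] by simp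
  then show ?case by blast
next
  case (Suc a)
  show ?case
  proof (cases b)
    case 0
    then show ?thesis using extremal_majority[of "Suc a"] by auto
  next
    case (Suc b')
    \<comment> \<open>Lowering both entries preserves their difference, so the pair reached at the
      end has exactly one zero entry.\<close>
    then have "a \<noteq> b'" using Suc.prems by simp
    moreover from this obtain V W :: "nat set" and E where "extremal a b' V W E"
      using Suc.IH by blast
    ultimately show ?thesis using extremal_Suc_Suc \<open>b = Suc b'\<close> by simp
  qed
qed

lemma extremal_admissible:
  assumes "extremal a b V W E"
  shows "admissible [a, b] (V \<union> W) E"
proof -
  have ext: "finite V" "finite W" "V \<inter> W = {}" "intersecting E"
    and E: "\<And>e. e \<in> E \<Longrightarrow> e \<subseteq> V \<union> W \<and> card (e \<inter> V) = a \<and> card (e \<inter> W) = b"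
    using assms by (auto simp: extremal_def)
  have "card e = a + b" if "e \<in> E" for e
  proof -
    have "e = (e \<inter> V) \<union> (e \<inter> W)" using E[OF that] by blast
    then have "card e = card (e \<inter> V) + card (e \<inter> W)"
      using ext by (metis card_Un_disjoint disjoint_iff finite_Int IntE)
    then show ?thesis using E[OF that] by simp
  qed
  then have "r_graph (sum_list [a, b]) (V \<union> W) E"
    using ext E unfolding r_graph_def hypergraph_def by simp blast
  moreover have "partitioned [a, b] (V \<union> W) E"
    unfolding partitioned_def using ext E
    by (intro exI[of _ "\<lambda>i. if i = 0 then V else W"])
      (auto simp: less_Suc_eq lessThan_Suc numeral_2_eq_2)
  ultimately show ?thesis using ext by (simp add: admissible_def)
qed

lemma extremal_le_tau:
  assumes "extremal a b V W E"
  shows "a + b \<le> tau (V \<union> W) E"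
proof -
  have fin: "finite (V \<union> W)" using assms by (simp add: extremal_def)
  \<comment> \<open>An edge meets itself, hence is nonempty. So the whole vertex set is a cover, and
    the minimum in \<open>tau\<close> is over a nonempty set.\<close>
  have "e \<subseteq> V \<union> W \<and> e \<noteq> {}" if "e \<in> E" for e
    using assms that by (auto simp: extremal_def intersecting_def)
  then have "is_cover (V \<union> W) E (V \<union> W)" by (fastforce simp: is_cover_def)
  moreover have "a + b \<le> card C" if "is_cover (V \<union> W) E C" for C
    using assms that finite_subset[OF _ fin, of C] by (simp add: extremal_def is_cover_def)
  ultimately show ?thesis
    unfolding tau_def using finite_cover_sizes[OF fin, of E] by (subst Min_ge_iff) auto
qed

theorem theorem1p2:
  fixes a b :: nat
  assumes "a > 0" and "b > 0" and "a \<noteq> b"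
  shows "t [a, b] = a + b"
proof (rule antisym)
  have "tau V E \<le> a + b" if "admissible [a, b] V E" for V :: "nat set" and E
    using tau_le_sum_list[OF that] by simp
  then show "t [a, b] \<le> a + b"
    unfolding t_def using finite_tau_values tau_values_nonempty by (subst Max_le_iff) auto
  obtain V W :: "nat set" and E where "extremal a b V W E"
    using ex_extremal[OF \<open>a \<noteq> b\<close>] by blast
  then show "a + b \<le> t [a, b]"
    using extremal_le_tau tau_le_t[OF extremal_admissible] by (meson order_trans)
qed

end
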